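(* There are absolute constants $c,C>0$ such that for every $N\ge2$, $d\ge1$ and every nonempty $S\subseteq\mathbb Z_N^d$ there is a subset $B\subseteq S$ satisfying $$|B|\geq c\,\mathcal A_N(S)^{-C}|S|,\qquad |B+B|\leq C\mathcal A_N(S)^C|B|.$$ Consequently, for fixed $d$, if $S_N\subseteq\mathbb Z_N^d$ are nonempty sets ($N$ ranging over an unbounded set of moduli) with $|S_N|=N^{\alpha+o(1)}$ and $\kappa(\{1_{S_N}\})=\frac{\alpha}{2}$, then $$E(S_N)=|S_N|^3N^{-o(1)},$$ and there are subsets $B_N\subseteq S_N$ with $$|B_N|\geq N^{-o(1)}|S_N|,\qquad |B_N+B_N|\leq N^{o(1)}|B_N|.$$
   Context: $\mathbb Z_N=\mathbb Z/N\mathbb Z$; all limits are taken within the given unbounded set of moduli. For $f:\mathbb Z_N^d\to\mathbb C$ the unitary Fourier transform is $\widehat f(\xi)=N^{-d/2}\sum_{x\in\mathbb Z_N^d}f(x)e^{-2\pi i x\cdot\xi/N}$. Norms use counting measure: $\|f\|_r=(\sum_x|f(x)|^r)^{1/r}$. $1_S$ is the indicator of $S$. For $f\neq0$, $\operatorname{FR}(f)=\|\widehat f\|_1/\|\widehat f\|_2$ and $\kappa_N(f)=\log\bigl(N^{d/2}/\operatorname{FR}(f)\bigr)/\log N$; $\kappa(\{f_N\})=\liminf_{N\to\infty}\kappa_N(f_N)$. The Fourier algebra norm is $\mathcal A_N(S)=N^{-d/2}\|\widehat{1_S}\|_1$. The additive energy is $E(S)=\#\{(x_1,x_2,x_3,x_4)\in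 S^4:x_1+x_2=x_3+x_4\}$, and $B+B=\{b+b':b,b'\in B\}$. $N^{\pm o(1)}$ denotes a positive factor whose logarithm divided by $\log N$ tends to zero, and $|S_N|=N^{\alpha+o(1)}$ means $\log|S_N|/\log N\to\alpha$. *)

theory Defs
  imports Complex_Main "HOL-Library.FuncSet" "HOL-Library.Indicator_Function"
    "HOL-Library.Liminf_Limsup" "HOL-Library.Extended_Real"
begin

text \<open>
  The group \<open>\<int>\<^sub>N\<^sup>d\<close> is modelled by an explicit carrier, because \<open>N\<close> and \<open>d\<close> are quantified
  inside the statement: an element is an extensional function on \<open>{..<d}\<close> whose values are
  the standard representatives \<open>0, \<dots>, N - 1\<close>.
\<close>

definition ZN :: "nat \<Rightarrow> nat \<Rightarrow> (nat \<Rightarrow> nat) set" where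
  "ZN N d = {..<d} \<rightarrow>\<^sub>E {..<N}"

definition vadd :: "nat \<Rightarrow> nat \<Rightarrow> (nat \<Rightarrow> nat) \<Rightarrow> (nat \<Rightarrow> nat) \<Rightarrow> (nat \<Rightarrow> nat)" where
  "vadd N d x y = (\<lambda>i\<in>{..<d}. (x i + y i) mod N)"

definition sumset :: "nat \<Rightarrow> nat \<Rightarrow> (nat \<Rightarrow> nat) set \<Rightarrow> (nat \<Rightarrow> nat) set \<Rightarrow> (nat \<Rightarrow> nat) set" where
  "sumset N d A B = {vadd N d a b | a b. a \<in> A \<and> b \<in> B}"

definition additive_energy :: "nat \<Rightarrow> nat \<Rightarrow> (nat \<Rightarrow> nat) set \<Rightarrow> nat" where
  "additive_energy N d S =
     card {(x1, x2, x3, x4). x1 \<in> S \<and> x2 \<in> S \<and> x3 \<in> S \<and> x4 \<in> S \<and>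
       vadd N d x1 x2 = vadd N d x3 x4}"

text \<open>
  The dot product below is computed on representatives in \<open>\<nat>\<close>; the character depends only
  on its residue modulo \<open>N\<close>.
\<close>

definition fourier :: "nat \<Rightarrow> nat \<Rightarrow> ((nat \<Rightarrow> nat) \<Rightarrow> complex) \<Rightarrow> (nat \<Rightarrow> nat) \<Rightarrow> complex" where
  "fourier N d f \<xi> = of_real (real N powr (- (real d / 2))) *
     (\<Sum>x\<in>ZN N d. f x * exp (- 2 * of_real pi * \<i> * of_nat (\<Sum>i<d. x i * \<xi> i) / of_nat N))"

definition lnorm :: "nat \<Rightarrow> nat \<Rightarrow> real \<Rightarrow> ((nat \<Rightarrow> nat) \<Rightarrow> complex) \<Rightarrow> real" where
  "lnorm N d r f = (\<Sum>x\<in>ZN N d. cmod (f x) powr r) powr (1 / r)"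

definition FR :: "nat \<Rightarrow> nat \<Rightarrow> ((nat \<Rightarrow> nat) \<Rightarrow> complex) \<Rightarrow> real" where
  "FR N d f = lnorm N d 1 (fourier N d f) / lnorm N d 2 (fourier N d f)"

definition kappa_at :: "nat \<Rightarrow> nat \<Rightarrow> ((nat \<Rightarrow> nat) \<Rightarrow> complex) \<Rightarrow> real" where
  "kappa_at N d f = ln (real N powr (real d / 2) / FR N d f) / ln (real N)"

definition fourier_algebra_norm :: "nat \<Rightarrow> nat \<Rightarrow> (nat \<Rightarrow> nat) set \<Rightarrow> real" where
  "fourier_algebra_norm N d S =
     real N powr (- (real d / 2)) * lnorm N d 1 (fourier N d (indicator S))"

text \<open>The filter \<open>N \<rightarrow> \<infinity>\<close> with \<open>N\<close> restricted to the set \<open>M\<close> of moduli.\<close>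

definition at_top_in :: "nat set \<Rightarrow> nat filter" where
  "at_top_in M = inf at_top (principal M)"

definition kappa :: "nat set \<Rightarrow> nat \<Rightarrow> (nat \<Rightarrow> (nat \<Rightarrow> nat) \<Rightarrow> complex) \<Rightarrow> ereal" where
  "kappa M d f = Liminf (at_top_in M) (\<lambda>N. ereal (kappa_at N d (f N)))"

text \<open>
  \<open>subpoly_factor M g\<close> says that \<open>g\<close> is a factor \<open>N\<^sup>o\<^sup>(\<^sup>1\<^sup>)\<close> along \<open>M\<close>. Nothing is said about the
  sign of the exponent, so the same predicate serves for a factor \<open>N\<^sup>-\<^sup>o\<^sup>(\<^sup>1\<^sup>)\<close>.
\<close>

definition subpoly_factor :: "nat set \<Rightarrow> (nat \<Rightarrow> real) \<Rightarrow> bool" where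
  "subpoly_factor M g \<longleftrightarrow> (\<forall>N\<in>M. g N > 0) \<and>
     ((\<lambda>N. ln (g N) / ln (real N)) \<longlongrightarrow> 0) (at_top_in M)"

end

theory Submission
  imports Defs "HOL-Algebra.Group" "HOL-Analysis.Convex"
begin

text \<open>
  Put \<open>A = \<A>\<^sub>N(S)\<close> and \<open>F = N\<^bsup>d/2\<^esup> \<cdot> (1\<^sub>S)^\<close>. The sums of \<open>|F|\<close>, \<open>|F|\<^sup>2\<close>, \<open>|F|\<^sup>4\<close> are \<open>N\<^sup>d\<close> times \<open>A\<close>, \<open>|S|\<close>,
  \<open>E(S)\<close>, so Holder's inequality gives \<open>E(S) \<ge> |S|\<^sup>3 / A\<^sup>2\<close>, and the Balog--Szemeredi--Gowers theorem
  yields \<open>B\<close>. For the latter, weight a pair \<open>(a, b)\<close> by the normalised number of representations of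
  \<open>a - b\<close> as a difference in \<open>S\<close>; dependent random choice finds a large \<open>P \<subseteq> S\<close> any two elements of which
  are joined by many walks of length four, so that every element of \<open>P - P\<close> has about \<open>|S|\<^sup>7\<close>
  representations as an alternating sum of eight elements of \<open>S\<close>. The asymptotic part follows from
  \<open>A = |S|\<^bsup>1/2\<^esup> N\<^bsup>-\<kappa>\<^esup>\<close> and \<open>A \<ge> 1\<close>, which turn the hypothesis on \<open>\<kappa>\<close> into \<open>A = N\<^bsup>o(1)\<^esup>\<close>.
\<close>

section \<open>Dependent random choice\<close>

text \<open>Read \<open>w\<close> as a weighted graph, \<open>c\<close> as the weight of paths of
  length two, and \<open>K\<close> as a bound for the inverse density. For a suitable
  \<open>v\<close>, each element of \<open>P\<close> is bad with at most a quarter of the weight at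
  \<open>v\<close>. Two elements of \<open>P\<close> therefore have good partners \<open>u\<close>
  in common that carry at least half of that weight, and each such \<open>u\<close> supplies many
  walks of length four.\<close>

lemma exists_set_with_many_walks:
  fixes w :: "'a \<Rightarrow> 'a \<Rightarrow> real" and S :: "'a set" and K :: real
  defines "c \<equiv> \<lambda>a b. \<Sum>v\<in>S. w a v * w b v"
  assumes fin: "finite S" and ne: "S \<noteq> {}"
    and w: "\<And>a b. a \<in> S \<Longrightarrow> b \<in> S \<Longrightarrow> 0 \<le> w a b \<and> w a b \<le> 1"
    and K: "K > 0" and dense: "(real (card S))\<^sup>2 \<le> K * (\<Sum>a\<in>S. \<Sum>b\<in>S. w a b)"
  obtains P where "P \<subseteq> S" "real (card S) \<le> 4 * K * real (card P)"
    "\<And>p q. p \<in> P \<Longrightarrow> q \<in> P \<Longrightarrow>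
      real (card S) ^ 3 / (4096 * K ^ 5) \<le> (\<Sum>u\<in>S. c p u * c q u)"
proof -
  define n where "n = real (card S)"
  have n: "n > 0" using fin ne by (simp add: n_def card_gt_0_iff)
  \<comment> \<open>With this value \<open>16 * \<epsilon> * n ^ 3\<close> is exactly half of the
    lower bound \<open>n ^ 3 / K^2\<close> for the second moment of \<open>d\<close>.\<close>
  define \<epsilon> where "\<epsilon> = 1 / (32 * K\<^sup>2)"
  have \<epsilon>: "\<epsilon> > 0" using K by (simp add: \<epsilon>_def)
  define d where "d v = (\<Sum>a\<in>S. w a v)" for v
  define bad where "bad a b \<longleftrightarrow> c a b < \<epsilon> * n" for a b
  define Bad where "Bad v = (\<Sum>a\<in>S. \<Sum>b\<in>S. if bad a b then w a v * w b v else 0)" for v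
  have d0: "0 \<le> d v" if "v \<in> S" for v using w that by (auto simp: d_def intro: sum_nonneg)
  have c0: "0 \<le> c a b" if "a \<in> S" "b \<in> S" for a b
    using w that by (auto simp: c_def intro!: sum_nonneg)
  have "(n\<^sup>2)\<^sup>2 \<le> (K * (\<Sum>v\<in>S. d v))\<^sup>2"
    using dense n unfolding n_def d_def by (subst sum.swap) (intro power_mono; simp)
  also have "\<dots> \<le> K\<^sup>2 * ((\<Sum>v\<in>S. (d v)\<^sup>2) * n)"
    unfolding power_mult_distrib n_def
    by (intro mult_left_mono sum_squared_le_sum_of_squares) simp
  finally have "n * n ^ 3 \<le> n * (K\<^sup>2 * (\<Sum>v\<in>S. (d v)\<^sup>2))"
    by (simp add: power2_eq_square power3_eq_cube mult_ac)
  hence d2: "n ^ 3 \<le> K\<^sup>2 * (\<Sum>v\<in>S. (d v)\<^sup>2)" using n by simp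
  have "(\<Sum>v\<in>S. Bad v) = (\<Sum>a\<in>S. \<Sum>v\<in>S. \<Sum>b\<in>S. if bad a b then w a v * w b v else 0)"
    unfolding Bad_def by (rule sum.swap)
  also have "\<dots> = (\<Sum>a\<in>S. \<Sum>b\<in>S. \<Sum>v\<in>S. if bad a b then w a v * w b v else 0)"
    by (intro sum.cong refl sum.swap)
  also have "\<dots> = (\<Sum>a\<in>S. \<Sum>b\<in>S. if bad a b then c a b else 0)"
    by (intro sum.cong refl) (auto simp: c_def)
  also have "\<dots> \<le> (\<Sum>a\<in>S. \<Sum>b\<in>S. \<epsilon> * n)"
    using \<epsilon> n by (intro sum_mono) (auto simp: bad_def)
  also have "\<dots> = \<epsilon> * n ^ 3" by (simp add: n_def power3_eq_cube)
  finally have sumBad: "(\<Sum>v\<in>S. Bad v) \<le> \<epsilon> * n ^ 3" .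
  txt \<open>The neighbourhood of a random \<open>v\<close> is large in mean square, but contains few bad pairs.\<close>
  have "\<exists>v\<in>S. n\<^sup>2 / (2 * K\<^sup>2) \<le> (d v)\<^sup>2 - 16 * Bad v"
  proof (rule ccontr)
    assume "\<not> ?thesis"
    hence "(\<Sum>v\<in>S. (d v)\<^sup>2 - 16 * Bad v) < (\<Sum>v\<in>S. n\<^sup>2 / (2 * K\<^sup>2))"
      using fin ne by (intro sum_strict_mono) auto
    hence "(\<Sum>v\<in>S. (d v)\<^sup>2) - 16 * (\<Sum>v\<in>S. Bad v) < n ^ 3 / (2 * K\<^sup>2)"
      by (simp add: sum_subtractf sum_distrib_left n_def power2_eq_square power3_eq_cube)
    moreover have "n ^ 3 / K\<^sup>2 \<le> (\<Sum>v\<in>S. (d v)\<^sup>2)"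
      using d2 K by (simp add: divide_simps mult.commute)
    moreover have "16 * (\<epsilon> * n ^ 3) = n ^ 3 / K\<^sup>2 - n ^ 3 / (2 * K\<^sup>2)"
      using K by (simp add: \<epsilon>_def field_simps)
    ultimately show False using sumBad by linarith
  qed
  then obtain v where v: "v \<in> S" and dv: "n\<^sup>2 / (2 * K\<^sup>2) \<le> (d v)\<^sup>2 - 16 * Bad v" by auto
  have Bad0: "Bad v \<ge> 0" using w v by (auto simp: Bad_def intro!: sum_nonneg)
  have dlow: "n / (2 * K) \<le> d v"
  proof (rule power2_le_imp_le)
    have "(n / (2 * K))\<^sup>2 \<le> n\<^sup>2 / (2 * K\<^sup>2)"
      using K n by (simp add: power_divide power_mult_distrib divide_simps)
    thus "(n / (2 * K))\<^sup>2 \<le> (d v)\<^sup>2" using dv Bad0 by linarith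
  qed (rule d0[OF v])
  have dpos: "d v > 0" by (rule less_le_trans[OF _ dlow]) (use n K in simp)
  have Badd: "Bad v \<le> (d v)\<^sup>2 / 16"
  proof -
    have "0 \<le> n\<^sup>2 / (2 * K\<^sup>2)" by simp
    thus ?thesis using dv by linarith
  qed
  define \<beta> where "\<beta> a = (\<Sum>b\<in>{b\<in>S. bad a b}. w b v)" for a
  \<comment> \<open>A Markov argument: elements outside \<open>P\<close> have \<open>\<beta>\<close>
    above \<open>d v / 4\<close>, while \<open>Bad v\<close> is at most \<open>(d v / 4)^2\<close>.
    Hence they carry at most a quarter of the weight at \<open>v\<close>; this is the origin of the
    factor 16.\<close>
  define P where "P = {a\<in>S. \<beta> a \<le> d v / 4}"
  have \<beta>0: "0 \<le> \<beta> a" for a using w v by (auto simp: \<beta>_def intro!: sum_nonneg)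
  have BadS: "Bad v = (\<Sum>a\<in>S. w a v * \<beta> a)"
    unfolding Bad_def \<beta>_def sum_distrib_left
    by (rule sum.cong[OF refl]) (simp add: sum.inter_filter[OF fin])
  have "(\<Sum>a\<in>S-P. w a v) * (d v / 4) = (\<Sum>a\<in>S-P. w a v * (d v / 4))"
    by (simp add: sum_distrib_right)
  also have "\<dots> \<le> (\<Sum>a\<in>S-P. w a v * \<beta> a)"
    using w v by (intro sum_mono mult_left_mono) (auto simp: P_def)
  also have "\<dots> \<le> Bad v" unfolding BadS
    using w v \<beta>0 fin by (intro sum_mono2) auto
  also have "\<dots> \<le> d v / 4 * (d v / 4)" using Badd by (simp add: power2_eq_square)
  finally have out: "(\<Sum>a\<in>S-P. w a v) \<le> d v / 4" using dpos by simp
  have PS: "P \<subseteq> S" by (auto simp: P_def)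
  have "d v = (\<Sum>a\<in>S-P. w a v) + (\<Sum>a\<in>P. w a v)"
    unfolding d_def using PS fin by (rule sum.subset_diff)
  moreover have "(\<Sum>a\<in>P. w a v) \<le> (\<Sum>a\<in>P. 1)"
    using w v PS by (intro sum_mono) auto
  ultimately have cardP: "3 / 4 * d v \<le> real (card P)" using out by simp
  show ?thesis
  proof (rule that[OF PS])
    have "n / (4 * K) \<le> real (card P)"
      using cardP dlow dpos by (simp add: field_simps)
    thus "real (card S) \<le> 4 * K * real (card P)"
      using K by (simp add: n_def field_simps)
  next
    fix p q assume p: "p \<in> P" and q: "q \<in> P"
    define U where "U = {u\<in>S. \<not> bad p u \<and> \<not> bad q u}"
    have U: "U \<subseteq> S" "finite U" using fin by (auto simp: U_def)
    \<comment> \<open>The set \<open>U\<close> and the two sets of bad partners cover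
      \<open>S\<close>. The bad ones weigh at most \<open>d v / 2\<close> together, so
      \<open>U\<close> keeps the other half, and weights bounded by 1 turn this into a bound on its
      cardinality.\<close>
    have "d v \<le> (\<Sum>u\<in>U \<union> ({b\<in>S. bad p b} \<union> {b\<in>S. bad q b}). w u v)"
      unfolding d_def using w v fin by (intro sum_mono2) (auto simp: U_def)
    also have "\<dots> \<le> (\<Sum>u\<in>U. w u v) + (\<Sum>u\<in>{b\<in>S. bad p b} \<union> {b\<in>S. bad q b}. w u v)"
      using w v fin by (subst sum.union_inter[symmetric]) (auto simp: U_def intro!: sum_nonneg)
    also have "(\<Sum>u\<in>{b\<in>S. bad p b} \<union> {b\<in>S. bad q b}. w u v) \<le> \<beta> p + \<beta> q"
      unfolding \<beta>_def
      using w v fin by (subst sum.union_inter[symmetric]) (auto simp: U_def intro!: sum_nonneg)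
    also have "\<beta> p + \<beta> q \<le> d v / 2" using p q by (simp add: P_def)
    also have "(\<Sum>u\<in>U. w u v) \<le> (\<Sum>u\<in>U. 1)"
      using w v U by (intro sum_mono) auto
    finally have cardU: "n / (4 * K) \<le> real (card U)" using dlow by (simp add: field_simps)
    \<comment> \<open>The constant is 4096 = 4 * 32^2: one factor from the size of \<open>U\<close>,
      two from \<open>\<epsilon>\<close>.\<close>
    have "n ^ 3 / (4096 * K ^ 5) = n / (4 * K) * ((\<epsilon> * n) * (\<epsilon> * n))"
      using K by (simp add: \<epsilon>_def field_simps eval_nat_numeral)
    also have "\<dots> \<le> real (card U) * ((\<epsilon> * n) * (\<epsilon> * n))"
      using cardU by (intro mult_right_mono) auto
    also have "\<dots> = (\<Sum>u\<in>U. (\<epsilon> * n) * (\<epsilon> * n))" by simp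
    also have "\<dots> \<le> (\<Sum>u\<in>U. c p u * c q u)"
      using \<epsilon> n c0 p q PS U by (intro sum_mono mult_mono) (auto simp: U_def bad_def)
    also have "\<dots> \<le> (\<Sum>u\<in>S. c p u * c q u)"
      using c0 p q PS U fin by (intro sum_mono2 mult_nonneg_nonneg) auto
    finally show "real (card S) ^ 3 / (4096 * K ^ 5) \<le> (\<Sum>u\<in>S. c p u * c q u)"
      by (simp add: n_def)
  qed
qed

section \<open>The Balog--Szemeredi--Gowers theorem in a finite abelian group\<close>

locale finite_comm_group = comm_group G for G (structure) +
  assumes finite_carrier: "finite (carrier G)"
begin

section \<open>Representation counts of differences and their convolutions\<close>

definition diff_count :: "'a set \<Rightarrow> 'a \<Rightarrow> real" where
  "diff_count S t = real (card {b\<in>S. t \<otimes> b \<in> S})"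

definition convolution :: "('a \<Rightarrow> real) \<Rightarrow> ('a \<Rightarrow> real) \<Rightarrow> 'a \<Rightarrow> real" where
  "convolution f g t = (\<Sum>s\<in>carrier G. f s * g (inv s \<otimes> t))"

definition diff_set :: "'a set \<Rightarrow> 'a set" where
  "diff_set S = (\<lambda>(a, b). a \<otimes> inv b) ` (S \<times> S)"

lemma diff_set_subset: "S \<subseteq> carrier G \<Longrightarrow> diff_set S \<subseteq> carrier G"
  by (auto simp: diff_set_def)

lemma finite_subset_carrier: "S \<subseteq> carrier G \<Longrightarrow> finite S"
  using finite_carrier finite_subset by blast

lemma diff_count_nonneg: "0 \<le> diff_count S t"
  by (simp add: diff_count_def)

lemma diff_count_le: "S \<subseteq> carrier G \<Longrightarrow> diff_count S t \<le> real (card S)"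
  unfolding diff_count_def using finite_subset_carrier by (simp add: card_mono)

text \<open>Exchanging the two elements of a pair inverts its difference; on second components the
  exchange is multiplication by \<open>t\<close>.\<close>

lemma diff_count_inv:
  assumes "S \<subseteq> carrier G" "t \<in> carrier G"
  shows "diff_count S (inv t) = diff_count S t"
proof -
  have "bij_betw (\<lambda>b. t \<otimes> b) {b\<in>S. t \<otimes> b \<in> S} {b\<in>S. inv t \<otimes> b \<in> S}"
    using assms
    by (intro bij_betwI[where g = "\<lambda>b. inv t \<otimes> b"]) (auto simp: m_assoc[symmetric] subset_iff)
  from bij_betw_same_card[OF this] show ?thesis by (simp add: diff_count_def)
qed

lemma diff_count_swap:
  assumes "S \<subseteq> carrier G" "a \<in> carrier G" "b \<in> carrier G"
  shows "diff_count S (a \<otimes> inv b) = diff_count S (b \<otimes> inv a)"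
  using diff_count_inv[OF assms(1), of "b \<otimes> inv a"] assms by (simp add: inv_mult_group)

lemma diff_count_eq_card_pairs:
  assumes "S \<subseteq> carrier G" "t \<in> carrier G"
  shows "diff_count S t = real (card {x\<in>S \<times> S. (case x of (a, b) \<Rightarrow> a \<otimes> inv b) = t})"
proof -
  have "bij_betw (\<lambda>b. (t \<otimes> b, b)) {b\<in>S. t \<otimes> b \<in> S}
          {x\<in>S \<times> S. (case x of (a, b) \<Rightarrow> a \<otimes> inv b) = t}"
    using assms by (intro bij_betwI[where g = snd]) (auto simp: m_assoc subset_iff)
  from bij_betw_same_card[OF this] show ?thesis by (simp add: diff_count_def)
qed

text \<open>Each pair is counted once, under its own difference. The free set \<open>D\<close>
  allows both the whole group, for the mass of a convolution, and the difference set, for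
  Cauchy-Schwarz.\<close>

lemma sum_diff_count:
  assumes "S \<subseteq> carrier G" "diff_set S \<subseteq> D" "D \<subseteq> carrier G"
  shows "(\<Sum>t\<in>D. diff_count S t) = (real (card S))\<^sup>2"
proof -
  have "(\<Sum>t\<in>D. diff_count S t) =
      (\<Sum>t\<in>D. \<Sum>x\<in>{x\<in>S \<times> S. (case x of (a, b) \<Rightarrow> a \<otimes> inv b) = t}. 1)"
    using assms by (intro sum.cong refl) (auto simp: diff_count_eq_card_pairs)
  also have "\<dots> = (\<Sum>x\<in>S \<times> S. 1)"
    using assms(2) finite_subset_carrier[OF assms(1)] finite_subset_carrier[OF assms(3)]
    by (intro sum.group) (auto simp: diff_set_def)
  finally show ?thesis by (simp add: card_cartesian_product power2_eq_square)
qed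

lemma sum_convolution:
  "(\<Sum>t\<in>carrier G. convolution f g t) = (\<Sum>s\<in>carrier G. f s) * (\<Sum>s\<in>carrier G. g s)"
proof -
  have "(\<Sum>t\<in>carrier G. g (inv s \<otimes> t)) = (\<Sum>t\<in>carrier G. g t)" if "s \<in> carrier G" for s
    using that
    by (intro sum.reindex_bij_witness[where i = "\<lambda>t. s \<otimes> t" and j = "\<lambda>t. inv s \<otimes> t"])
       (auto simp: m_assoc[symmetric])
  thus ?thesis
    unfolding convolution_def
    by (subst sum.swap) (simp add: sum_distrib_left[symmetric] sum_distrib_right)
qed

text \<open>Substituting \<open>s = p \<otimes> inv v\<close> writes the convolution as a sum over
  all intermediate points \<open>v\<close>, and nonnegative terms may be dropped. Thus walks through
  \<open>A\<close> are bounded by values of a convolution.\<close>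

lemma convolution_ge:
  assumes "\<And>t. 0 \<le> f t" "\<And>t. 0 \<le> g t" "A \<subseteq> carrier G" "p \<in> carrier G" "q \<in> carrier G"
  shows "(\<Sum>v\<in>A. f (p \<otimes> inv v) * g (v \<otimes> inv q)) \<le> convolution f g (p \<otimes> inv q)"
proof -
  have "(\<Sum>v\<in>A. f (p \<otimes> inv v) * g (v \<otimes> inv q)) \<le>
      (\<Sum>v\<in>carrier G. f (p \<otimes> inv v) * g (v \<otimes> inv q))"
    using assms finite_carrier by (intro sum_mono2) auto
  also have "\<dots> = convolution f g (p \<otimes> inv q)"
    unfolding convolution_def
  proof (rule sum.reindex_bij_witness[where i = "\<lambda>s. inv s \<otimes> p" and j = "\<lambda>v. p \<otimes> inv v"])
    fix v assume v: "v \<in> carrier G"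
    have "inv p \<otimes> (p \<otimes> inv q) = inv q"
      using assms by (simp add: m_assoc[symmetric])
    hence "inv (p \<otimes> inv v) \<otimes> (p \<otimes> inv q) = v \<otimes> inv q"
      using v assms by (simp add: inv_mult_group m_assoc)
    thus "f (p \<otimes> inv v) * g (inv (p \<otimes> inv v) \<otimes> (p \<otimes> inv q)) = f (p \<otimes> inv v) * g (v \<otimes> inv q)"
      using v assms by simp
    show "inv (p \<otimes> inv v) \<otimes> p = v" using v assms by (simp add: inv_mult_group m_assoc)
  next
    fix s assume s: "s \<in> carrier G"
    show "p \<otimes> inv (inv s \<otimes> p) = s"
      using s assms by (simp add: inv_mult_group m_assoc[symmetric])
  qed (use assms in auto)
  finally show ?thesis .
qed

text \<open>Double counting: the fourfold convolution \<open>r4\<close> of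
  \<open>diff_count S\<close> has total mass \<open>n ^ 8\<close>, while the walks of length four
  give it at least \<open>n ^ 7 / (4096 * K ^ 5)\<close> at every difference of
  \<open>P\<close>.\<close>

lemma small_diff_set:
  fixes K :: real
  assumes S: "S \<subseteq> carrier G" "S \<noteq> {}" and K: "K > 0"
    and energy: "real (card S) ^ 3 \<le> K * (\<Sum>a\<in>S. \<Sum>b\<in>S. diff_count S (a \<otimes> inv b))"
  obtains P where "P \<subseteq> S" "real (card S) \<le> 4 * K * real (card P)"
    "real (card (diff_set P)) \<le> 4096 * K ^ 5 * real (card S)"
proof -
  define n where "n = real (card S)"
  have n: "n > 0" using S finite_subset_carrier by (auto simp: n_def card_gt_0_iff)
  \<comment> \<open>A difference has at most \<open>n\<close> representations, so dividing by
    \<open>n\<close> puts the weights into the unit interval.\<close>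
  define w where "w a b = diff_count S (a \<otimes> inv b) / n" for a b
  define r2 where "r2 = convolution (diff_count S) (diff_count S)"
  define r4 where "r4 = convolution r2 r2"
  have w01: "0 \<le> w a b \<and> w a b \<le> 1" for a b
    using n diff_count_nonneg diff_count_le[OF S(1)] by (simp add: w_def n_def)
  have "n ^ 3 \<le> n * (K * (\<Sum>a\<in>S. \<Sum>b\<in>S. w a b))"
    using energy n by (simp add: w_def n_def flip: sum_divide_distrib)
  hence dense: "n\<^sup>2 \<le> K * (\<Sum>a\<in>S. \<Sum>b\<in>S. w a b)"
    using n by (simp add: power2_eq_square power3_eq_cube mult.assoc)
  obtain P where P: "P \<subseteq> S" "real (card S) \<le> 4 * K * real (card P)"
    and walks: "\<And>p q. p \<in> P \<Longrightarrow> q \<in> P \<Longrightarrow> n ^ 3 / (4096 * K ^ 5) \<le>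
      (\<Sum>u\<in>S. (\<Sum>v\<in>S. w p v * w u v) * (\<Sum>v\<in>S. w q v * w u v))"
    using exists_set_with_many_walks[OF finite_subset_carrier[OF S(1)] S(2) w01 K dense[unfolded n_def]]
    unfolding n_def by blast
  have wswap: "w a b = w b a" if "a \<in> S" "b \<in> S" for a b
    using that S diff_count_swap[OF S(1), of a b] by (auto simp: w_def)
  have r2_nonneg: "0 \<le> r2 t" for t
    unfolding r2_def convolution_def by (intro sum_nonneg mult_nonneg_nonneg diff_count_nonneg)
  have r4_nonneg: "0 \<le> r4 t" for t
    unfolding r4_def convolution_def by (intro sum_nonneg mult_nonneg_nonneg r2_nonneg)
  have r2_ge: "n\<^sup>2 * (\<Sum>v\<in>S. w p v * w v q) \<le> r2 (p \<otimes> inv q)" if "p \<in> S" "q \<in> S" for p q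
  proof -
    have "n\<^sup>2 * (\<Sum>v\<in>S. w p v * w v q) =
        (\<Sum>v\<in>S. diff_count S (p \<otimes> inv v) * diff_count S (v \<otimes> inv q))"
      using n by (simp add: w_def sum_distrib_left power2_eq_square)
    also have "\<dots> \<le> r2 (p \<otimes> inv q)"
      unfolding r2_def using S that by (intro convolution_ge diff_count_nonneg) auto
    finally show ?thesis .
  qed
  have r4_ge: "n ^ 7 / (4096 * K ^ 5) \<le> r4 t" if t: "t \<in> diff_set P" for t
  proof -
    obtain p q where pq: "p \<in> P" "q \<in> P" "t = p \<otimes> inv q" using t by (auto simp: diff_set_def)
    \<comment> \<open>The factor \<open>n ^ 4\<close> undoes the normalisation of the four weights
      along a walk.\<close>
    have "n ^ 7 / (4096 * K ^ 5) = n ^ 4 * (n ^ 3 / (4096 * K ^ 5))"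
      by (simp flip: power_add)
    also have "\<dots> \<le> n ^ 4 * (\<Sum>u\<in>S. (\<Sum>v\<in>S. w p v * w u v) * (\<Sum>v\<in>S. w q v * w u v))"
      using walks pq by (intro mult_left_mono) auto
    also have "\<dots> = (\<Sum>u\<in>S. (n\<^sup>2 * (\<Sum>v\<in>S. w p v * w u v)) * (n\<^sup>2 * (\<Sum>v\<in>S. w q v * w u v)))"
      unfolding sum_distrib_left[of "n ^ 4"]
      by (intro sum.cong refl) (simp add: eval_nat_numeral algebra_simps)
    \<comment> \<open>Symmetry of \<open>w\<close> lets the walk be read in one direction, from
      \<open>p\<close> through \<open>u\<close> to \<open>q\<close>, so that its differences
      multiply up to \<open>p \<otimes> inv q\<close>.\<close>
    also have "\<dots> = (\<Sum>u\<in>S. (n\<^sup>2 * (\<Sum>v\<in>S. w p v * w v u)) * (n\<^sup>2 * (\<Sum>v\<in>S. w u v * w v q)))"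
    proof -
      have "(\<Sum>v\<in>S. w p v * w u v) = (\<Sum>v\<in>S. w p v * w v u)"
        "(\<Sum>v\<in>S. w q v * w u v) = (\<Sum>v\<in>S. w u v * w v q)" if "u \<in> S" for u
        using that pq P wswap[of u] wswap[of q] by (auto intro!: sum.cong)
      thus ?thesis by simp
    qed
    also have "\<dots> \<le> (\<Sum>u\<in>S. r2 (p \<otimes> inv u) * r2 (u \<otimes> inv q))"
      using pq P w01 by (intro sum_mono mult_mono r2_ge r2_nonneg mult_nonneg_nonneg sum_nonneg) auto
    also have "\<dots> \<le> r4 t"
      unfolding r4_def pq(3) using S pq P by (intro convolution_ge r2_nonneg) auto
    finally show ?thesis .
  qed
  have D: "diff_set P \<subseteq> carrier G" using P S by (intro diff_set_subset) auto
  have "real (card (diff_set P)) * (n ^ 7 / (4096 * K ^ 5)) = (\<Sum>t\<in>diff_set P. n ^ 7 / (4096 * K ^ 5))"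
    by simp
  also have "\<dots> \<le> (\<Sum>t\<in>diff_set P. r4 t)" using r4_ge by (intro sum_mono)
  also have "\<dots> \<le> (\<Sum>t\<in>carrier G. r4 t)"
    using D r4_nonneg finite_carrier by (intro sum_mono2) auto
  also have "\<dots> = n ^ 8"
    unfolding r4_def r2_def sum_convolution
    using sum_diff_count[OF S(1) diff_set_subset[OF S(1)] order_refl]
    by (simp add: n_def flip: power_add power_mult)
  finally have "real (card (diff_set P)) * n ^ 7 \<le> (4096 * K ^ 5 * n) * n ^ 7"
    using K by (simp add: field_simps eval_nat_numeral)
  hence "real (card (diff_set P)) \<le> 4096 * K ^ 5 * n" using n by simp
  with P that show ?thesis by (simp add: n_def)
qed

text \<open>In additive notation, \<open>a - b + c\<close> and \<open>a + c - b\<close> are the same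
  element, so renaming \<open>b\<close> and \<open>c\<close> shows that the energy can be counted by
  differences or by sums.\<close>

lemma sum_diff_count_diffs_eq:
  assumes P: "P \<subseteq> carrier G"
  shows "(\<Sum>a\<in>P. \<Sum>b\<in>P. diff_count P (a \<otimes> inv b)) =
    (\<Sum>a\<in>P. \<Sum>b\<in>P. real (card {c\<in>P. a \<otimes> b \<otimes> inv c \<in> P}))"
proof -
  have fin: "finite P" using P by (rule finite_subset_carrier)
  have "(\<Sum>a\<in>P. \<Sum>b\<in>P. diff_count P (a \<otimes> inv b)) =
      (\<Sum>a\<in>P. \<Sum>b\<in>P. \<Sum>c\<in>P. of_bool (a \<otimes> inv b \<otimes> c \<in> P))"
    using fin by (simp add: diff_count_def sum.If_cases of_bool_def Int_def)
  also have "\<dots> = (\<Sum>a\<in>P. \<Sum>c\<in>P. \<Sum>b\<in>P. of_bool (a \<otimes> inv b \<otimes> c \<in> P))"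
    by (intro sum.cong refl sum.swap)
  also have "\<dots> = (\<Sum>a\<in>P. \<Sum>c\<in>P. \<Sum>b\<in>P. of_bool (a \<otimes> c \<otimes> inv b \<in> P))"
  proof (intro sum.cong refl)
    fix a b c assume "a \<in> P" "b \<in> P" "c \<in> P"
    hence "a \<otimes> inv b \<otimes> c = a \<otimes> c \<otimes> inv b" using P by (auto simp: m_ac subset_iff)
    thus "(of_bool (a \<otimes> inv b \<otimes> c \<in> P) :: real) = of_bool (a \<otimes> c \<otimes> inv b \<in> P)" by simp
  qed
  also have "\<dots> = (\<Sum>a\<in>P. \<Sum>b\<in>P. real (card {c\<in>P. a \<otimes> b \<otimes> inv c \<in> P}))"
    using fin by (simp add: sum.If_cases of_bool_def Int_def)
  finally show ?thesis .
qed

text \<open>Grouping pairs by their difference makes the double sum the second moment of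
  \<open>diff_count P\<close>. Cauchy-Schwarz on the difference set compares it with the total mass
  \<open>(card P)^2\<close>.\<close>

lemma sum_diff_count_diffs_ge:
  assumes P: "P \<subseteq> carrier G"
  shows "real (card P) ^ 4 \<le>
    real (card (diff_set P)) * (\<Sum>a\<in>P. \<Sum>b\<in>P. diff_count P (a \<otimes> inv b))"
proof -
  have fin: "finite P" using P by (rule finite_subset_carrier)
  define D where "D = diff_set P"
  have D: "D \<subseteq> carrier G" "finite D"
    using diff_set_subset[OF P] finite_subset_carrier by (auto simp: D_def)
  have "(\<Sum>a\<in>P. \<Sum>b\<in>P. diff_count P (a \<otimes> inv b)) =
      (\<Sum>x\<in>P \<times> P. diff_count P (case x of (a, b) \<Rightarrow> a \<otimes> inv b))"
    by (simp add: sum.cartesian_product case_prod_unfold)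
  also have "\<dots> = (\<Sum>t\<in>D. \<Sum>x\<in>{x\<in>P \<times> P. (case x of (a, b) \<Rightarrow> a \<otimes> inv b) = t}.
      diff_count P (case x of (a, b) \<Rightarrow> a \<otimes> inv b))"
    using fin D by (intro sum.group[symmetric]) (auto simp: D_def diff_set_def)
  also have "\<dots> = (\<Sum>t\<in>D. (diff_count P t)\<^sup>2)"
  proof (intro sum.cong refl)
    fix t assume "t \<in> D"
    hence t: "t \<in> carrier G" using D by auto
    have "(\<Sum>x\<in>{x\<in>P \<times> P. (case x of (a, b) \<Rightarrow> a \<otimes> inv b) = t}.
        diff_count P (case x of (a, b) \<Rightarrow> a \<otimes> inv b)) =
        (\<Sum>x\<in>{x\<in>P \<times> P. (case x of (a, b) \<Rightarrow> a \<otimes> inv b) = t}. diff_count P t)"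
      by (intro sum.cong) auto
    also have "\<dots> = (diff_count P t)\<^sup>2"
      using diff_count_eq_card_pairs[OF P t] by (simp add: power2_eq_square)
    finally show "(\<Sum>x\<in>{x\<in>P \<times> P. (case x of (a, b) \<Rightarrow> a \<otimes> inv b) = t}.
        diff_count P (case x of (a, b) \<Rightarrow> a \<otimes> inv b)) = (diff_count P t)\<^sup>2" .
  qed
  finally have "(\<Sum>t\<in>D. diff_count P t)\<^sup>2 \<le>
      (\<Sum>a\<in>P. \<Sum>b\<in>P. diff_count P (a \<otimes> inv b)) * real (card D)"
    using sum_squared_le_sum_of_squares[of "diff_count P" D] by simp
  moreover have "(\<Sum>t\<in>D. diff_count P t)\<^sup>2 = real (card P) ^ 4"
    using sum_diff_count[OF P _ D(1)] by (simp add: D_def flip: power_mult)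
  ultimately show ?thesis by (simp add: D_def mult.commute)
qed

text \<open>
  Passing from differences to sums: for \<open>B = P \<inter> (t - P)\<close> one has \<open>B + B \<subseteq> t + (P - P)\<close>, and some
  \<open>t\<close> makes \<open>B\<close> large because the energy of \<open>P\<close> does not distinguish sums from differences.
\<close>

lemma diff_set_bounds_symmetric_part:
  assumes P: "P \<subseteq> carrier G" "P \<noteq> {}"
  obtains B where "B \<subseteq> P" "(real (card P))\<^sup>2 \<le> real (card (diff_set P)) * real (card B)"
    "card ((\<lambda>(a, b). a \<otimes> b) ` (B \<times> B)) \<le> card (diff_set P)"
proof -
  have fin: "finite P" using P by (auto intro: finite_subset_carrier)
  define B where "B t = {c\<in>P. t \<otimes> inv c \<in> P}" for t
  define m where "m = real (card P)"
  define D where "D = real (card (diff_set P))"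
  have m: "m > 0" using P fin by (simp add: m_def card_gt_0_iff)
  \<comment> \<open>Averaging over the \<open>m^2\<close> pairs: the right-hand sides add up to at
    least \<open>m ^ 4\<close>.\<close>
  have "\<exists>a\<in>P. \<exists>b\<in>P. m\<^sup>2 \<le> D * real (card (B (a \<otimes> b)))"
  proof (rule ccontr)
    assume "\<not> ?thesis"
    hence "(\<Sum>a\<in>P. \<Sum>b\<in>P. D * real (card (B (a \<otimes> b)))) < (\<Sum>a\<in>P. \<Sum>b\<in>P. m\<^sup>2)"
      using fin P by (intro sum_strict_mono) (auto simp: not_le)
    also have "\<dots> = m ^ 4" by (simp add: m_def eval_nat_numeral)
    also have "\<dots> \<le> D * (\<Sum>a\<in>P. \<Sum>b\<in>P. diff_count P (a \<otimes> inv b))"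
      unfolding m_def D_def by (rule sum_diff_count_diffs_ge[OF P(1)])
    also have "\<dots> = (\<Sum>a\<in>P. \<Sum>b\<in>P. D * real (card (B (a \<otimes> b))))"
      unfolding sum_diff_count_diffs_eq[OF P(1)] B_def by (simp add: sum_distrib_left)
    finally show False by simp
  qed
  then obtain a b where ab: "a \<in> P" "b \<in> P" and large: "m\<^sup>2 \<le> D * real (card (B (a \<otimes> b)))"
    by blast
  define t where "t = a \<otimes> b"
  have t: "t \<in> carrier G" using ab P by (auto simp: t_def)
  have "(\<lambda>(a, b). a \<otimes> b) ` (B t \<times> B t) \<subseteq> (\<lambda>s. t \<otimes> s) ` diff_set P"
  proof clarify
    fix x y assume x: "x \<in> B t" and y: "y \<in> B t"
    have xy: "x \<in> carrier G" "y \<in> carrier G" using x y P by (auto simp: B_def)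
    \<comment> \<open>Since \<open>y\<close> lies in \<open>B t\<close>, the point
      \<open>t - y\<close> lies in \<open>P\<close>, and \<open>x + y = t + (x - (t - y))\<close> in
      additive notation.\<close>
    have "x \<otimes> inv (t \<otimes> inv y) \<in> diff_set P"
      using x y by (auto simp: B_def diff_set_def intro!: image_eqI[where x = "(x, t \<otimes> inv y)"])
    moreover have "t \<otimes> (x \<otimes> inv (t \<otimes> inv y)) = t \<otimes> (x \<otimes> y \<otimes> inv t)"
      using xy t by (simp add: inv_mult_group m_assoc)
    hence "x \<otimes> y = t \<otimes> (x \<otimes> inv (t \<otimes> inv y))"
      using xy t by (simp add: m_comm[of "x \<otimes> y"] m_assoc[symmetric])
    ultimately show "x \<otimes> y \<in> (\<lambda>s. t \<otimes> s) ` diff_set P" by blast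
  qed
  hence "card ((\<lambda>(a, b). a \<otimes> b) ` (B t \<times> B t)) \<le> card ((\<lambda>s. t \<otimes> s) ` diff_set P)"
    using fin by (intro card_mono) (auto simp: diff_set_def)
  also have "\<dots> \<le> card (diff_set P)" using fin by (intro card_image_le) (auto simp: diff_set_def)
  finally show ?thesis
    using large by (intro that[of "B t"]) (auto simp: B_def m_def D_def t_def)
qed

text \<open>The first three entries determine the fourth, so quadruples correspond to triples with
  \<open>a + b - c\<close> in the set. Counting these by sums and converting to differences gives
  the right-hand side.\<close>

lemma card_additive_quadruples:
  assumes S: "S \<subseteq> carrier G"
  shows "real (card {(x1, x2, x3, x4). x1 \<in> S \<and> x2 \<in> S \<and> x3 \<in> S \<and> x4 \<in> S \<and>
      x1 \<otimes> x2 = x3 \<otimes> x4}) = (\<Sum>a\<in>S. \<Sum>b\<in>S. diff_count S (a \<otimes> inv b))"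
proof -
  have fin: "finite S" using S by (rule finite_subset_carrier)
  have solve: "d = a \<otimes> b \<otimes> inv c \<longleftrightarrow> a \<otimes> b = c \<otimes> d"
    if "a \<in> S" "b \<in> S" "c \<in> S" "d \<in> S" for a b c d
    using that S inv_solve_right[of d "a \<otimes> b" c] m_comm[of c d] by (auto simp: subset_iff)
  define T where "T p = {c\<in>S. fst p \<otimes> snd p \<otimes> inv c \<in> S}" for p
  have "bij_betw (\<lambda>(a, b, c, d). ((a, b), c))
      {(x1, x2, x3, x4). x1 \<in> S \<and> x2 \<in> S \<and> x3 \<in> S \<and> x4 \<in> S \<and> x1 \<otimes> x2 = x3 \<otimes> x4}
      (Sigma (S \<times> S) T)"
  proof (rule bij_betwI[where g = "\<lambda>((a, b), c). (a, b, c, a \<otimes> b \<otimes> inv c)"])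
    show "(\<lambda>(a, b, c, d). ((a, b), c)) \<in>
        {(x1, x2, x3, x4). x1 \<in> S \<and> x2 \<in> S \<and> x3 \<in> S \<and> x4 \<in> S \<and> x1 \<otimes> x2 = x3 \<otimes> x4} \<rightarrow>
        Sigma (S \<times> S) T"
      using solve by (auto simp: T_def) metis
    show "(\<lambda>((a, b), c). (a, b, c, a \<otimes> b \<otimes> inv c)) \<in> Sigma (S \<times> S) T \<rightarrow>
        {(x1, x2, x3, x4). x1 \<in> S \<and> x2 \<in> S \<and> x3 \<in> S \<and> x4 \<in> S \<and> x1 \<otimes> x2 = x3 \<otimes> x4}"
      using solve[THEN iffD1, OF _ _ _ _ refl] by (auto simp: T_def)
  qed (use solve in \<open>auto simp: T_def\<close>)
  hence "card {(x1, x2, x3, x4). x1 \<in> S \<and> x2 \<in> S \<and> x3 \<in> S \<and> x4 \<in> S \<and> x1 \<otimes> x2 = x3 \<otimes> x4} =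
      card (Sigma (S \<times> S) T)"
    by (rule bij_betw_same_card)
  also have "\<dots> = (\<Sum>p\<in>S \<times> S. card (T p))"
    using fin by (intro card_SigmaI) (auto simp: T_def)
  finally show ?thesis
    unfolding sum_diff_count_diffs_eq[OF S]
    by (simp add: T_def sum.cartesian_product case_prod_unfold)
qed

text \<open>Large energy gives a large \<open>P\<close> with few differences; its part
  \<open>B\<close>, symmetric under a reflection, has no more sums than \<open>P\<close> has
  differences.\<close>

theorem Balog_Szemeredi_Gowers:
  fixes K :: real
  assumes S: "S \<subseteq> carrier G" "S \<noteq> {}" and K: "K > 0"
    and energy: "real (card S) ^ 3 \<le> K * (\<Sum>a\<in>S. \<Sum>b\<in>S. diff_count S (a \<otimes> inv b))"
  obtains B where "B \<subseteq> S" "real (card S) \<le> 2 ^ 16 * K ^ 7 * real (card B)"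
    "real (card ((\<lambda>(a, b). a \<otimes> b) ` (B \<times> B))) \<le> 2 ^ 28 * K ^ 12 * real (card B)"
proof -
  define n where "n = real (card S)"
  have n: "n > 0" using S finite_subset_carrier by (auto simp: n_def card_gt_0_iff)
  obtain P where P: "P \<subseteq> S" "n \<le> 4 * K * real (card P)"
    and D: "real (card (diff_set P)) \<le> 4096 * K ^ 5 * n"
    using small_diff_set[OF assms] unfolding n_def by blast
  have "P \<noteq> {}" "P \<subseteq> carrier G" using P n S by auto
  then obtain B where B: "B \<subseteq> P" "(real (card P))\<^sup>2 \<le> real (card (diff_set P)) * real (card B)"
    "card ((\<lambda>(a, b). a \<otimes> b) ` (B \<times> B)) \<le> card (diff_set P)"
    using diff_set_bounds_symmetric_part by blast
  \<comment> \<open>The bounds compose to 16 * 4096 = 2^16 with \<open>K ^ (2 + 5)\<close>.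
    Inserting the result into the bound for the differences gives 4096 * 2^16 = 2^28 with
    \<open>K ^ (5 + 7)\<close>.\<close>
  have "n\<^sup>2 \<le> (4 * K * real (card P))\<^sup>2" using P n by (intro power_mono) auto
  also have "\<dots> = 16 * K\<^sup>2 * (real (card P))\<^sup>2" by (simp add: power_mult_distrib)
  also have "\<dots> \<le> 16 * K\<^sup>2 * (real (card (diff_set P)) * real (card B))"
    using B K by (intro mult_left_mono) auto
  also have "\<dots> \<le> 16 * K\<^sup>2 * ((4096 * K ^ 5 * n) * real (card B))"
    using D K by (intro mult_left_mono mult_right_mono) auto
  also have "\<dots> = n * (2 ^ 16 * (K\<^sup>2 * K ^ 5) * real (card B))"
    by simp
  also have "K\<^sup>2 * K ^ 5 = K ^ 7"
    by (simp flip: power_add)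
  finally have nB: "n \<le> 2 ^ 16 * K ^ 7 * real (card B)"
    using n by (simp add: power2_eq_square)
  have "real (card ((\<lambda>(a, b). a \<otimes> b) ` (B \<times> B))) \<le> 4096 * K ^ 5 * n"
    using B(3) D by linarith
  also have "\<dots> \<le> 4096 * K ^ 5 * (2 ^ 16 * K ^ 7 * real (card B))"
    using nB K by (intro mult_left_mono) auto
  also have "\<dots> = 2 ^ 28 * (K ^ 5 * K ^ 7) * real (card B)"
    by simp
  also have "K ^ 5 * K ^ 7 = K ^ 12"
    by (simp flip: power_add)
  finally show ?thesis using that[of B] B P nB by (simp add: n_def)
qed

end

section \<open>Fourier analysis of indicators\<close>

text \<open>The product form makes sums over all frequencies factor into sums over single
  coordinates.\<close>

definition character :: "nat \<Rightarrow> nat \<Rightarrow> (nat \<Rightarrow> nat) \<Rightarrow> (nat \<Rightarrow> nat) \<Rightarrow> complex" where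
  "character N d \<xi> x = (\<Prod>i<d. cis (- 2 * pi * real (x i * \<xi> i) / real N))"

lemma exp_eq_character:
  "exp (- 2 * of_real pi * \<i> * of_nat (\<Sum>i<d. x i * \<xi> i) / of_nat N) = character N d \<xi> x"
proof -
  have "- 2 * of_real pi * \<i> * of_nat (\<Sum>i<d. x i * \<xi> i) / of_nat N =
      (\<Sum>i<d. \<i> * of_real (- 2 * pi * real (x i * \<xi> i) / real N))"
    by (simp add: sum_distrib_left sum_divide_distrib sum_negf mult_ac)
  thus ?thesis by (simp only: exp_sum finite_lessThan character_def cis_conv_exp)
qed

section \<open>Characters of the finite group and their orthogonality\<close>

lemma finite_ZN: "finite (ZN N d)"
  by (simp add: ZN_def finite_PiE)

lemma vadd_in_ZN: "N > 0 \<Longrightarrow> vadd N d x y \<in> ZN N d"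
  by (simp add: ZN_def vadd_def)

text \<open>Reducing \<open>a\<close> modulo \<open>N\<close> moves the angle by an integer multiple
  of \<open>2 * pi\<close>. This makes characters compatible with the reduction inside
  \<open>vadd\<close>.\<close>

lemma cis_mod:
  assumes "N > 0"
  shows "cis (- 2 * pi * real ((a mod N) * k) / real N) = cis (- 2 * pi * real (a * k) / real N)"
proof -
  have "real (a * k) = real (a mod N * k) + real N * real (a div N * k)"
    by (metis (no_types, lifting) of_nat_add of_nat_mult mod_mult_div_eq distrib_right mult.assoc)
  hence "- 2 * pi * real (a * k) / real N =
      - 2 * pi * real (a mod N * k) / real N - 2 * pi * real (a div N * k)"
    using assms by (simp add: field_simps)
  hence "cis (- 2 * pi * real (a * k) / real N) =
      cis (- 2 * pi * real (a mod N * k) / real N) / cis (2 * pi * real (a div N * k))"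
    by (simp only: cis_divide)
  also have "cis (2 * pi * real (a div N * k)) = 1"
    by (rule cis_multiple_2pi) simp
  finally show ?thesis by simp
qed

lemma character_vadd:
  assumes "N > 0"
  shows "character N d \<xi> (vadd N d x y) = character N d \<xi> x * character N d \<xi> y"
  unfolding character_def prod.distrib[symmetric]
proof (intro prod.cong refl)
  fix i assume "i \<in> {..<d}"
  hence "cis (- 2 * pi * real (vadd N d x y i * \<xi> i) / real N) =
      cis (- 2 * pi * real ((x i + y i) * \<xi> i) / real N)"
    using cis_mod[OF assms] by (simp add: vadd_def)
  also have "- 2 * pi * real ((x i + y i) * \<xi> i) / real N =
      - 2 * pi * real (x i * \<xi> i) / real N + - 2 * pi * real (y i * \<xi> i) / real N"
    using assms by (simp add: field_simps)
  finally show "cis (- 2 * pi * real (vadd N d x y i * \<xi> i) / real N) =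
      cis (- 2 * pi * real (x i * \<xi> i) / real N) * cis (- 2 * pi * real (y i * \<xi> i) / real N)"
    by (simp only: cis_mult)
qed

text \<open>A geometric sum whose ratio \<open>z\<close> satisfies \<open>z ^ N = 1\<close>. If
  \<open>z = 1\<close>, then \<open>N\<close> divides \<open>b - a\<close>, which for
  representatives below \<open>N\<close> forces equality.\<close>

lemma sum_cis_orthogonal:
  assumes "a < N" "b < N"
  shows "(\<Sum>k<N. cis (- 2 * pi * real (a * k) / real N) * cnj (cis (- 2 * pi * real (b * k) / real N))) =
    (if a = b then of_nat N else 0)"
proof -
  define z where "z = cis (2 * pi * (real b - real a) / real N)"
  have N: "N > 0" using assms by simp
  have z: "cis (- 2 * pi * real (a * k) / real N) * cnj (cis (- 2 * pi * real (b * k) / real N)) = z ^ k" for k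
  proof -
    have "- 2 * pi * real (a * k) / real N + - (- 2 * pi * real (b * k) / real N) =
        real k * (2 * pi * (real b - real a) / real N)"
      using N by (simp add: field_simps)
    thus ?thesis unfolding z_def DeMoivre cis_cnj cis_mult by simp
  qed
  have "z ^ N = cis (2 * pi * of_int (int b - int a))"
    unfolding z_def DeMoivre using N by simp
  hence zN: "z ^ N = 1" using cis_multiple_2pi[of "of_int (int b - int a)"] by simp
  have "z \<noteq> 1" if "a \<noteq> b"
  proof
    assume "z = 1"
    hence "cos (2 * pi * (real b - real a) / real N) = 1"
      by (simp add: z_def complex_eq_iff)
    then obtain m :: int where "2 * pi * (real b - real a) / real N = of_int m * (2 * pi)"
      by (auto simp: cos_one_2pi_int mult_ac)
    hence "(2 * pi) * (real b - real a) = (2 * pi) * (of_int m * real N)"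
      using N by (simp add: field_simps)
    hence "real b - real a = of_int m * real N" by (subst (asm) mult_cancel_left) simp
    hence "of_int (int b - int a) = (of_int (m * int N) :: real)" by simp
    hence "int b - int a = m * int N" by (simp only: of_int_eq_iff)
    hence "int b mod int N = int a mod int N" by (simp add: mod_eq_dvd_iff)
    thus False using that assms by simp
  qed
  thus ?thesis
    unfolding z using zN N geometric_sum[of z N] by (auto simp: z_def)
qed

text \<open>The sum over frequencies factors by coordinates, and a single coordinate where
  \<open>x\<close> and \<open>y\<close> differ makes the product vanish.\<close>

lemma character_orthogonal:
  assumes "x \<in> ZN N d" "y \<in> ZN N d"
  shows "(\<Sum>\<xi>\<in>ZN N d. character N d \<xi> x * cnj (character N d \<xi> y)) =
    (if x = y then of_nat (N ^ d) else 0)"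
proof -
  have "(\<Sum>\<xi>\<in>ZN N d. character N d \<xi> x * cnj (character N d \<xi> y)) =
    (\<Prod>i<d. \<Sum>k<N. cis (- 2 * pi * real (x i * k) / real N) * cnj (cis (- 2 * pi * real (y i * k) / real N)))"
    unfolding ZN_def by (subst prod_sum_PiE) (simp_all add: character_def prod.distrib)
  also have "\<dots> = (\<Prod>i<d. if x i = y i then of_nat N else 0)"
    using assms by (intro prod.cong refl sum_cis_orthogonal) (auto simp: ZN_def)
  also have "\<dots> = (if x = y then of_nat (N ^ d) else 0)"
  proof (cases "x = y")
    case False
    then obtain i where "i < d" "x i \<noteq> y i"
      using assms unfolding ZN_def by (metis PiE_ext lessThan_iff)
    thus ?thesis using False by (auto intro!: prod_zero)
  qed simp
  finally show ?thesis .
qed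

text \<open>Expanding the square and using orthogonality leaves the coincidences of
  \<open>\<phi>\<close>. The indexed form serves twice: the identity on \<open>S\<close> gives
  Parseval, and addition on \<open>S \<times> S\<close> gives the additive energy.\<close>

lemma sum_norm_character_sum_sq:
  assumes "finite I" "\<phi> ` I \<subseteq> ZN N d"
  shows "(\<Sum>\<xi>\<in>ZN N d. (cmod (\<Sum>i\<in>I. character N d \<xi> (\<phi> i)))\<^sup>2) =
    real N ^ d * real (card {(i, j). i \<in> I \<and> j \<in> I \<and> \<phi> i = \<phi> j})"
proof -
  have "of_real (\<Sum>\<xi>\<in>ZN N d. (cmod (\<Sum>i\<in>I. character N d \<xi> (\<phi> i)))\<^sup>2) =
      (\<Sum>\<xi>\<in>ZN N d. \<Sum>i\<in>I. \<Sum>j\<in>I. character N d \<xi> (\<phi> i) * cnj (character N d \<xi> (\<phi> j)))"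
    unfolding of_real_sum complex_norm_square cnj_sum sum_product ..
  also have "\<dots> = (\<Sum>i\<in>I. \<Sum>j\<in>I. \<Sum>\<xi>\<in>ZN N d. character N d \<xi> (\<phi> i) * cnj (character N d \<xi> (\<phi> j)))"
    by (subst sum.swap) (intro sum.cong refl sum.swap)
  also have "\<dots> = (\<Sum>i\<in>I. \<Sum>j\<in>I. if \<phi> i = \<phi> j then of_nat (N ^ d) else 0)"
    using assms by (intro sum.cong refl character_orthogonal) auto
  also have "\<dots> = (\<Sum>x\<in>I \<times> I. if \<phi> (fst x) = \<phi> (snd x) then of_nat (N ^ d) else 0)"
    by (simp add: sum.cartesian_product case_prod_unfold)
  also have "\<dots> = of_nat (N ^ d) * of_nat (card {(i, j). i \<in> I \<and> j \<in> I \<and> \<phi> i = \<phi> j})"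
  proof -
    have "{x \<in> I \<times> I. \<phi> (fst x) = \<phi> (snd x)} = {(i, j). i \<in> I \<and> j \<in> I \<and> \<phi> i = \<phi> j}" by auto
    thus ?thesis using assms by (simp flip: sum.inter_filter)
  qed
  finally have "complex_of_real (\<Sum>\<xi>\<in>ZN N d. (cmod (\<Sum>i\<in>I. character N d \<xi> (\<phi> i)))\<^sup>2) =
      complex_of_real (real N ^ d * real (card {(i, j). i \<in> I \<and> j \<in> I \<and> \<phi> i = \<phi> j}))"
    by simp
  thus ?thesis by (simp only: of_real_eq_iff)
qed

lemma sum_norm_character_sum_sq_set:
  assumes "S \<subseteq> ZN N d"
  shows "(\<Sum>\<xi>\<in>ZN N d. (cmod (\<Sum>x\<in>S. character N d \<xi> x))\<^sup>2) = real N ^ d * real (card S)"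
proof -
  have "{(i, j). i \<in> S \<and> j \<in> S \<and> i = j} = (\<lambda>x. (x, x)) ` S" by auto
  hence "card {(i, j). i \<in> S \<and> j \<in> S \<and> i = j} = card S" by (simp add: card_image inj_on_def)
  thus ?thesis
    using sum_norm_character_sum_sq[of S "\<lambda>x. x" N d] assms finite_subset[OF assms finite_ZN] by simp
qed

lemma fourier_indicator:
  assumes "S \<subseteq> ZN N d"
  shows "fourier N d (indicator S) \<xi> =
    of_real (real N powr (- (real d / 2))) * (\<Sum>x\<in>S. character N d \<xi> x)"
proof -
  have "(\<Sum>x\<in>ZN N d. indicator S x * character N d \<xi> x) = (\<Sum>x\<in>S. character N d \<xi> x)"
    using assms finite_ZN by (intro sum.mono_neutral_cong_right) (auto simp: indicator_def)
  thus ?thesis unfolding fourier_def exp_eq_character by simp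
qed

section \<open>The group structure and the energy bound\<close>

lemma comm_group_ZN:
  assumes "N > 0"
  shows "comm_group \<lparr>carrier = ZN N d, mult = vadd N d, one = \<lambda>i\<in>{..<d}. 0\<rparr>"
proof (rule comm_groupI; simp only: partial_object.simps monoid.simps)
  show "(\<lambda>i\<in>{..<d}. 0) \<in> ZN N d" using assms by (auto simp: ZN_def)
next
  fix x y z assume xyz: "x \<in> ZN N d" "y \<in> ZN N d" "z \<in> ZN N d"
  show "vadd N d (vadd N d x y) z = vadd N d x (vadd N d y z)"
    by (auto simp: vadd_def mod_add_left_eq mod_add_right_eq add.assoc)
next
  fix x y assume "x \<in> ZN N d" "y \<in> ZN N d"
  show "vadd N d x y \<in> ZN N d" using assms by (rule vadd_in_ZN)
  show "vadd N d x y = vadd N d y x" by (auto simp: vadd_def add.commute)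
next
  fix x assume x: "x \<in> ZN N d"
  show "vadd N d (\<lambda>i\<in>{..<d}. 0) x = x"
    using x by (auto simp: ZN_def vadd_def fun_eq_iff PiE_iff extensional_def)
  \<comment> \<open>The reduction of \<open>N - x i\<close> matters when \<open>x i = 0\<close>,
    because \<open>N\<close> itself is not a representative.\<close>
  have "vadd N d (\<lambda>i\<in>{..<d}. (N - x i) mod N) x = (\<lambda>i\<in>{..<d}. 0)"
  proof (unfold vadd_def, intro restrict_ext)
    fix i assume i: "i \<in> {..<d}"
    hence "x i < N" using x by (auto simp: ZN_def)
    thus "((\<lambda>i\<in>{..<d}. (N - x i) mod N) i + x i) mod N = 0" using i by (simp add: mod_add_left_eq)
  qed
  moreover have "(\<lambda>i\<in>{..<d}. (N - x i) mod N) \<in> ZN N d" using assms by (auto simp: ZN_def)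
  ultimately show "\<exists>y\<in>ZN N d. vadd N d y x = (\<lambda>i\<in>{..<d}. 0)" by blast
qed

text \<open>The second moment of \<open>F\<close> is interpolated between the first, which is the
  Fourier algebra norm up to \<open>Q\<close>, and the fourth, which is the energy up to
  \<open>Q\<close>.\<close>

lemma additive_energy_ge:
  assumes N: "N > 0" and S: "S \<subseteq> ZN N d" "S \<noteq> {}"
  shows "real (card S) ^ 3 \<le> (fourier_algebra_norm N d S)\<^sup>2 * real (additive_energy N d S)"
proof -
  define F where "F \<xi> = cmod (\<Sum>x\<in>S. character N d \<xi> x)" for \<xi>
  define Q where "Q = real N ^ d"
  define n where "n = real (card S)"
  define A where "A = fourier_algebra_norm N d S"
  define E where "E = real (additive_energy N d S)"
  have fin: "finite S" using S finite_ZN finite_subset by blast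
  have Q: "Q > 0" using N by (simp add: Q_def)
  have n: "n > 0" using S fin by (simp add: n_def card_gt_0_iff)
  have F0: "F \<xi> \<ge> 0" for \<xi> by (simp add: F_def)
  have F2: "(\<Sum>\<xi>\<in>ZN N d. (F \<xi>)\<^sup>2) = Q * n"
    unfolding F_def Q_def n_def by (rule sum_norm_character_sum_sq_set[OF S(1)])
  define V where "V = (\<lambda>(x, y). vadd N d x y)"
  \<comment> \<open>The square of a character sum is a character sum over the sums of pairs, so the
    fourth moment counts coincidences between such sums.\<close>
  have sq: "(F \<xi>)\<^sup>2 = cmod (\<Sum>p\<in>S \<times> S. character N d \<xi> (V p))" for \<xi>
    by (simp add: F_def power2_eq_square V_def character_vadd[OF N] sum_product sum.cartesian_product
        case_prod_unfold flip: norm_mult)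
  have closed: "V ` (S \<times> S) \<subseteq> ZN N d" using vadd_in_ZN[OF N] by (auto simp: V_def)
  have "bij_betw (\<lambda>((a, b), (c, d)). (a, b, c, d))
      {(p, q). p \<in> S \<times> S \<and> q \<in> S \<times> S \<and> V p = V q}
      {(x1, x2, x3, x4). x1 \<in> S \<and> x2 \<in> S \<and> x3 \<in> S \<and> x4 \<in> S \<and>
       vadd N d x1 x2 = vadd N d x3 x4}"
    by (intro bij_betwI[where g = "\<lambda>(a, b, c, d). ((a, b), (c, d))"]) (auto simp: V_def)
  hence "additive_energy N d S = card {(p, q). p \<in> S \<times> S \<and> q \<in> S \<times> S \<and> V p = V q}"
    unfolding additive_energy_def by (simp add: bij_betw_same_card)
  moreover have "(F \<xi>) ^ 4 = (cmod (\<Sum>p\<in>S \<times> S. character N d \<xi> (V p)))\<^sup>2" for \<xi>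
    unfolding sq[symmetric] by simp
  ultimately have F4: "(\<Sum>\<xi>\<in>ZN N d. (F \<xi>) ^ 4) = Q * E"
    using sum_norm_character_sum_sq[of "S \<times> S" V N d] fin closed
    by (simp add: Q_def E_def)
  \<comment> \<open>One factor \<open>N powr (- d / 2)\<close> comes from the norm and one from the
    unitary transform; together they give \<open>1 / Q\<close>.\<close>
  have "A = real N powr (- (real d / 2)) * (\<Sum>\<xi>\<in>ZN N d. real N powr (- (real d / 2)) * F \<xi>)"
    by (simp add: A_def fourier_algebra_norm_def lnorm_def fourier_indicator[OF S(1)] norm_mult F_def
        sum_nonneg)
  also have "\<dots> = real N powr (- real d) * (\<Sum>\<xi>\<in>ZN N d. F \<xi>)"
    by (simp add: mult.assoc[symmetric] flip: sum_distrib_left powr_add)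
  also have "real N powr (- real d) = 1 / Q"
    using N by (simp add: powr_minus_divide powr_realpow Q_def)
  finally have F1: "(\<Sum>\<xi>\<in>ZN N d. F \<xi>) = Q * A" using Q by simp
  txt \<open>Holder for the exponents 1, 2, 4, as two applications of Cauchy--Schwarz.\<close>
  define F3 where "F3 = (\<Sum>\<xi>\<in>ZN N d. (F \<xi>) ^ 3)"
  have "(\<Sum>\<xi>\<in>ZN N d. sqrt (F \<xi>) * (sqrt (F \<xi>) * F \<xi>))\<^sup>2 \<le>
      (\<Sum>\<xi>\<in>ZN N d. (sqrt (F \<xi>))\<^sup>2) * (\<Sum>\<xi>\<in>ZN N d. (sqrt (F \<xi>) * F \<xi>)\<^sup>2)"
    by (rule Cauchy_Schwarz_ineq_sum)
  moreover have "sqrt (F \<xi>) * (sqrt (F \<xi>) * F \<xi>) = (F \<xi>)\<^sup>2" "(sqrt (F \<xi>) * F \<xi>)\<^sup>2 = (F \<xi>) ^ 3" for \<xi>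
    using F0[of \<xi>]
    by (simp_all add: mult.assoc[symmetric] power2_eq_square[of "F \<xi>"] power_mult_distrib power3_eq_cube)
  ultimately have cs1: "(Q * n)\<^sup>2 \<le> (Q * A) * F3"
    using F0 by (simp add: F3_def F1[symmetric] F2[symmetric])
  have "(\<Sum>\<xi>\<in>ZN N d. F \<xi> * (F \<xi>)\<^sup>2)\<^sup>2 \<le> (\<Sum>\<xi>\<in>ZN N d. (F \<xi>)\<^sup>2) * (\<Sum>\<xi>\<in>ZN N d. ((F \<xi>)\<^sup>2)\<^sup>2)"
    by (rule Cauchy_Schwarz_ineq_sum)
  hence cs2: "F3\<^sup>2 \<le> (Q * n) * (Q * E)"
    by (simp add: F3_def F2[symmetric] F4[symmetric] power2_eq_square power3_eq_cube power4_eq_xxxx mult.assoc)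
  \<comment> \<open>The third moment is eliminated by squaring \<open>cs1\<close> and inserting
    \<open>cs2\<close>; then \<open>Q ^ 4 * n\<close> cancels.\<close>
  have "((Q * n)\<^sup>2)\<^sup>2 \<le> ((Q * A) * F3)\<^sup>2"
    using cs1 by (intro power_mono) auto
  also have "\<dots> = (Q * A)\<^sup>2 * F3\<^sup>2" by (simp add: power_mult_distrib)
  also have "\<dots> \<le> (Q * A)\<^sup>2 * ((Q * n) * (Q * E))" using cs2 by (intro mult_left_mono) auto
  finally have "(Q ^ 4 * n) * n ^ 3 \<le> (Q ^ 4 * n) * (A\<^sup>2 * E)"
    by (simp add: eval_nat_numeral mult_ac)
  thus ?thesis using Q n by (simp add: A_def E_def n_def)
qed

section \<open>Sets of small Fourier algebra norm\<close>

lemma finite_comm_group_ZN: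
  "N > 0 \<Longrightarrow> finite_comm_group \<lparr>carrier = ZN N d, mult = vadd N d, one = \<lambda>i\<in>{..<d}. 0\<rparr>"
  by (simp add: finite_comm_group_def finite_comm_group_axioms_def comm_group_ZN finite_ZN)

lemma additive_energy_eq_sum:
  fixes G
  assumes N: "N > 0" and S: "S \<subseteq> ZN N d"
  defines "G \<equiv> \<lparr>carrier = ZN N d, mult = vadd N d, one = \<lambda>i\<in>{..<d}. 0\<rparr>"
  shows "real (additive_energy N d S) =
    (\<Sum>a\<in>S. \<Sum>b\<in>S. finite_comm_group.diff_count G S (a \<otimes>\<^bsub>G\<^esub> inv\<^bsub>G\<^esub> b))"
proof -
  interpret finite_comm_group G unfolding G_def using N by (rule finite_comm_group_ZN)
  show ?thesis
    using card_additive_quadruples[of S] S by (simp add: additive_energy_def G_def)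
qed

text \<open>Each difference has at most \<open>card S\<close> representations. This trivial bound
  yields both \<open>1 \<le> \<A>\<close> for the Fourier algebra norm and the upper half of the
  asymptotic energy estimate.\<close>

lemma additive_energy_le:
  assumes N: "N > 0" and S: "S \<subseteq> ZN N d"
  shows "real (additive_energy N d S) \<le> real (card S) ^ 3"
proof -
  define G where "G = \<lparr>carrier = ZN N d, mult = vadd N d, one = \<lambda>i\<in>{..<d}. 0\<rparr>"
  interpret finite_comm_group G unfolding G_def using N by (rule finite_comm_group_ZN)
  have "real (additive_energy N d S) = (\<Sum>a\<in>S. \<Sum>b\<in>S. diff_count S (a \<otimes>\<^bsub>G\<^esub> inv\<^bsub>G\<^esub> b))"
    unfolding G_def using N S by (rule additive_energy_eq_sum)
  also have "\<dots> \<le> (\<Sum>a\<in>S. \<Sum>b\<in>S. real (card S))"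
    using S by (intro sum_mono diff_count_le) (simp add: G_def)
  finally show ?thesis by (simp add: power3_eq_cube)
qed

text \<open>The lower and upper energy bounds together give
  \<open>n ^ 3 \<le> A^2 * n ^ 3\<close>.\<close>

lemma fourier_algebra_norm_ge_1:
  assumes N: "N > 0" and S: "S \<subseteq> ZN N d" "S \<noteq> {}"
  shows "1 \<le> fourier_algebra_norm N d S"
proof -
  define n where "n = real (card S)"
  define A where "A = fourier_algebra_norm N d S"
  have n: "n > 0" using S finite_subset[OF S(1) finite_ZN] by (simp add: n_def card_gt_0_iff)
  have A0: "0 \<le> A" by (simp add: A_def fourier_algebra_norm_def lnorm_def)
  have "n ^ 3 \<le> A\<^sup>2 * real (additive_energy N d S)"
    unfolding n_def A_def by (rule additive_energy_ge[OF assms])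
  also have "\<dots> \<le> A\<^sup>2 * n ^ 3"
    unfolding n_def by (intro mult_left_mono additive_energy_le[OF N S(1)]) simp
  finally have "1 \<le> A\<^sup>2" using n by simp
  hence "1 \<le> A" using A0 by (intro power2_le_imp_le[of 1 A]) simp_all
  thus ?thesis by (simp add: A_def)
qed

text \<open>The energy bound allows \<open>K = A^2\<close> in the Balog-Szemeredi-Gowers theorem,
  which doubles the exponents 7 and 12.\<close>

lemma small_doubling_subset:
  assumes N: "N > 0" and S: "S \<subseteq> ZN N d" "S \<noteq> {}"
  defines "A \<equiv> fourier_algebra_norm N d S"
  obtains B where "B \<subseteq> S" "real (card S) \<le> 2 ^ 16 * A ^ 14 * real (card B)"
    "real (card (sumset N d B B)) \<le> 2 ^ 28 * A ^ 24 * real (card B)"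
proof -
  define G where "G = \<lparr>carrier = ZN N d, mult = vadd N d, one = \<lambda>i\<in>{..<d}. 0\<rparr>"
  interpret finite_comm_group G unfolding G_def using N by (rule finite_comm_group_ZN)
  have A: "A > 0" using fourier_algebra_norm_ge_1[OF N S] by (simp add: A_def)
  have "real (card S) ^ 3 \<le> A\<^sup>2 * (\<Sum>a\<in>S. \<Sum>b\<in>S. diff_count S (a \<otimes>\<^bsub>G\<^esub> inv\<^bsub>G\<^esub> b))"
    using additive_energy_ge[OF N S] additive_energy_eq_sum[OF N S(1)]
    by (simp add: A_def G_def)
  moreover have "S \<subseteq> carrier G" "A\<^sup>2 > 0" using S A by (simp_all add: G_def)
  ultimately obtain B where B: "B \<subseteq> S"
    "real (card S) \<le> 2 ^ 16 * (A\<^sup>2) ^ 7 * real (card B)"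
    "real (card ((\<lambda>(a, b). a \<otimes>\<^bsub>G\<^esub> b) ` (B \<times> B))) \<le> 2 ^ 28 * (A\<^sup>2) ^ 12 * real (card B)"
    using S(2) Balog_Szemeredi_Gowers by metis
  have "sumset N d B B = (\<lambda>(a, b). a \<otimes>\<^bsub>G\<^esub> b) ` (B \<times> B)"
    by (auto simp: sumset_def G_def)
  thus ?thesis using B that[of B] by (simp flip: power_mult)
qed

text \<open>One number has to serve as factor and as exponent. Since the norm is at least 1, the
  exponents 14 and 24 may be raised to \<open>2 ^ 28\<close>, the factor in the doubling
  bound.\<close>

lemma small_doubling_subset_powr:
  assumes N: "N > 0" and S: "S \<subseteq> ZN N d" "S \<noteq> {}"
  shows "\<exists>B\<subseteq>S. real (card B) \<ge> 1 / 2 ^ 16 * fourier_algebra_norm N d S powr (- (2 ^ 28)) * real (card S) \<and>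
    real (card (sumset N d B B)) \<le> 2 ^ 28 * fourier_algebra_norm N d S powr (2 ^ 28) * real (card B)"
proof -
  define A where "A = fourier_algebra_norm N d S"
  have A: "A \<ge> 1" unfolding A_def by (rule fourier_algebra_norm_ge_1[OF assms])
  have le: "A ^ k \<le> A powr (2 ^ 28)" if "k \<le> 2 ^ 28" for k
  proof -
    have "A ^ k = A powr real k" using A by (simp add: powr_realpow)
    also have "\<dots> \<le> A powr (2 ^ 28)"
    proof (rule powr_mono[OF _ A])
      show "real k \<le> 2 ^ 28" using that by (metis of_nat_le_iff of_nat_numeral of_nat_power)
    qed
    finally show ?thesis .
  qed
  obtain B where B: "B \<subseteq> S" "real (card S) \<le> 2 ^ 16 * A ^ 14 * real (card B)"
    "real (card (sumset N d B B)) \<le> 2 ^ 28 * A ^ 24 * real (card B)"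
    using small_doubling_subset[OF assms] unfolding A_def by blast
  have "real (card S) \<le> 2 ^ 16 * A powr (2 ^ 28) * real (card B)"
    by (rule order_trans[OF B(2)]) (intro mult_right_mono mult_left_mono le; simp)
  hence "1 / 2 ^ 16 * A powr (- (2 ^ 28)) * real (card S) \<le>
      1 / 2 ^ 16 * A powr (- (2 ^ 28)) * (2 ^ 16 * A powr (2 ^ 28) * real (card B))"
    by (intro mult_left_mono) simp_all
  also have "\<dots> = (A powr (- (2 ^ 28)) * A powr (2 ^ 28)) * real (card B)" by simp
  also have "A powr (- (2 ^ 28)) * A powr (2 ^ 28) = 1"
    using A by (subst powr_add[symmetric]) simp
  finally have "1 / 2 ^ 16 * A powr (- (2 ^ 28)) * real (card S) \<le> real (card B)" by simp
  moreover have "real (card (sumset N d B B)) \<le> 2 ^ 28 * A powr (2 ^ 28) * real (card B)"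
    by (rule order_trans[OF B(3)]) (intro mult_right_mono mult_left_mono le; simp)
  ultimately show ?thesis using B(1) unfolding A_def by blast
qed

section \<open>The exponent \<open>kappa_at\<close> of an indicator\<close>

lemma lnorm_fourier_indicator:
  assumes N: "N > 0" and S: "S \<subseteq> ZN N d"
  shows "lnorm N d 2 (fourier N d (indicator S)) = sqrt (real (card S))"
proof -
  have "(\<Sum>\<xi>\<in>ZN N d. (cmod (fourier N d (indicator S) \<xi>))\<^sup>2) =
      (\<Sum>\<xi>\<in>ZN N d. (real N powr (- (real d / 2)))\<^sup>2 * (cmod (\<Sum>x\<in>S. character N d \<xi> x))\<^sup>2)"
    by (simp add: fourier_indicator[OF S] norm_mult power_mult_distrib)
  also have "\<dots> = (real N powr (- (real d / 2)))\<^sup>2 * (real N ^ d * real (card S))"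
    unfolding sum_distrib_left[symmetric] by (simp only: sum_norm_character_sum_sq_set[OF S])
  also have "(real N powr (- (real d / 2)))\<^sup>2 = 1 / real N ^ d"
    using N by (simp add: power2_eq_square powr_minus_divide powr_realpow flip: powr_add)
  finally have "(\<Sum>\<xi>\<in>ZN N d. (cmod (fourier N d (indicator S) \<xi>))\<^sup>2) = real (card S)"
    using N by simp
  thus ?thesis by (simp add: lnorm_def powr_half_sqrt)
qed

text \<open>By Parseval \<open>FR = Q * A / sqrt n\<close>, hence
  \<open>Q / FR = sqrt n / A\<close>; this is the logarithmic form of
  \<open>A = sqrt n * N powr (- kappa)\<close>.\<close>

lemma ln_fourier_algebra_norm:
  assumes N: "N \<ge> 2" and S: "S \<subseteq> ZN N d" "S \<noteq> {}"
  shows "ln (fourier_algebra_norm N d S) / ln (real N) =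
    ln (real (card S)) / ln (real N) / 2 - kappa_at N d (indicator S)"
proof -
  define n where "n = real (card S)"
  define A where "A = fourier_algebra_norm N d S"
  define l where "l = lnorm N d 1 (fourier N d (indicator S))"
  define Q where "Q = real N powr (real d / 2)"
  have N0: "N > 0" using N by simp
  have n: "n > 0" using S finite_subset[OF S(1) finite_ZN] by (simp add: n_def card_gt_0_iff)
  have A: "A > 0" using fourier_algebra_norm_ge_1[OF N0 S] by (simp add: A_def)
  have Q: "Q > 0" using N by (simp add: Q_def)
  have lA: "l = Q * A"
    using Q by (simp add: A_def fourier_algebra_norm_def l_def Q_def powr_minus_divide)
  have "Q / FR N d (indicator S) = sqrt n / A"
    using Q by (simp add: FR_def lnorm_fourier_indicator[OF N0 S(1)] flip: l_def n_def) (simp add: lA)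
  hence "kappa_at N d (indicator S) = (ln n / 2 - ln A) / ln (real N)"
    using n A by (simp add: kappa_at_def Q_def ln_div ln_sqrt)
  thus ?thesis by (simp add: A_def n_def diff_divide_distrib)
qed

section \<open>Asymptotics along the set of moduli\<close>

lemma eventually_at_top_in: "eventually (\<lambda>N. N \<in> M) (at_top_in M)"
  by (simp add: at_top_in_def eventually_inf_principal)

text \<open>This absorbs absolute constants into factors \<open>N^(o(1))\<close>.\<close>

lemma inverse_ln_tendsto_0: "((\<lambda>N. c / ln (real N)) \<longlongrightarrow> 0) (at_top_in M)"
proof (rule tendsto_mono)
  show "at_top_in M \<le> at_top" by (simp add: at_top_in_def)
  show "((\<lambda>N. c / ln (real N)) \<longlongrightarrow> 0) at_top"
    by (intro tendsto_divide_0[OF tendsto_const] filterlim_at_top_imp_at_infinity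
        filterlim_compose[OF ln_at_top] filterlim_real_sequentially)
qed

text \<open>The logarithm splits into that of the constant and \<open>r\<close> times that of
  \<open>A N\<close>. Arbitrary real \<open>r\<close> covers the density factor and the doubling
  factor alike.\<close>

lemma subpoly_factor_powr:
  assumes "\<And>N. N \<in> M \<Longrightarrow> A N > 0" "c > 0"
    and "((\<lambda>N. ln (A N) / ln (real N)) \<longlongrightarrow> 0) (at_top_in M)"
  shows "subpoly_factor M (\<lambda>N. c * A N powr r)"
  unfolding subpoly_factor_def
proof
  have "((\<lambda>N. ln c / ln (real N) + r * (ln (A N) / ln (real N))) \<longlongrightarrow> 0 + r * 0) (at_top_in M)"
    by (intro tendsto_intros assms inverse_ln_tendsto_0)
  moreover have "eventually (\<lambda>N. ln c / ln (real N) + r * (ln (A N) / ln (real N)) =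
      ln (c * A N powr r) / ln (real N)) (at_top_in M)"
    using eventually_at_top_in
  proof eventually_elim
    case (elim N)
    thus ?case using assms(1)[of N] assms(2) by (simp add: ln_mult ln_powr add_divide_distrib)
  qed
  ultimately show "((\<lambda>N. ln (c * A N powr r) / ln (real N)) \<longlongrightarrow> 0) (at_top_in M)"
    by (simp add: tendsto_cong)
qed (use assms in force)

text \<open>The norm is at least 1, which bounds the quotient from below. The liminf bounds
  \<open>kappa_at\<close> from below, and as \<open>kappa_at\<close> enters the logarithm of the
  norm with a minus sign, this bounds the quotient from above.\<close>

lemma fourier_algebra_norm_subpolynomial:
  assumes M: "M \<subseteq> {2..}" and S: "\<And>N. N \<in> M \<Longrightarrow> S N \<subseteq> ZN N d \<and> S N \<noteq> {}"
    and card: "((\<lambda>N. ln (real (card (S N))) / ln (real N)) \<longlongrightarrow> \<alpha>) (at_top_in M)"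
    and kappa: "kappa M d (\<lambda>N. indicator (S N)) = ereal (\<alpha> / 2)"
  shows "((\<lambda>N. ln (fourier_algebra_norm N d (S N)) / ln (real N)) \<longlongrightarrow> 0) (at_top_in M)"
proof (rule order_tendstoI)
  fix e :: real assume e: "e < 0"
  show "eventually (\<lambda>N. e < ln (fourier_algebra_norm N d (S N)) / ln (real N)) (at_top_in M)"
    using eventually_at_top_in
  proof eventually_elim
    case (elim N)
    hence "N \<ge> 2" using M by auto
    hence "0 \<le> ln (fourier_algebra_norm N d (S N)) / ln (real N)"
      using fourier_algebra_norm_ge_1[of N "S N" d] S[OF elim] by simp
    thus ?case using e by linarith
  qed
next
  fix e :: real assume e: "0 < e"
  \<comment> \<open>The tolerance is split evenly: half of \<open>\<alpha> + e\<close> minus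
    \<open>\<alpha> / 2 - e / 2\<close> is exactly \<open>e\<close>.\<close>
  have "ereal (\<alpha> / 2 - e / 2) < kappa M d (\<lambda>N. indicator (S N))"
    using e by (simp add: kappa)
  hence "eventually (\<lambda>N. ereal (\<alpha> / 2 - e / 2) < ereal (kappa_at N d (indicator (S N)))) (at_top_in M)"
    unfolding kappa_def by (rule less_LiminfD)
  moreover have "eventually (\<lambda>N. ln (real (card (S N))) / ln (real N) < \<alpha> + e) (at_top_in M)"
    using order_tendstoD(2)[OF card] e by simp
  ultimately show "eventually (\<lambda>N. ln (fourier_algebra_norm N d (S N)) / ln (real N) < e) (at_top_in M)"
    using eventually_at_top_in
  proof eventually_elim
    case (elim N)
    hence "N \<ge> 2" using M by auto
    hence "ln (fourier_algebra_norm N d (S N)) / ln (real N) =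
        ln (real (card (S N))) / ln (real N) / 2 - kappa_at N d (indicator (S N))"
      using S[OF elim(3)] by (intro ln_fourier_algebra_norm) auto
    thus ?case using elim(1,2) by simp
  qed
qed

text \<open>The two energy bounds squeeze the logarithm of the ratio between
  \<open>-2 * ln A\<close> and 0.\<close>

lemma energy_ratio_subpoly_factor:
  assumes M: "M \<subseteq> {2..}" and S: "\<And>N. N \<in> M \<Longrightarrow> S N \<subseteq> ZN N d \<and> S N \<noteq> {}"
    and A: "((\<lambda>N. ln (fourier_algebra_norm N d (S N)) / ln (real N)) \<longlongrightarrow> 0) (at_top_in M)"
  shows "subpoly_factor M (\<lambda>N. real (additive_energy N d (S N)) / real (card (S N)) ^ 3)"
proof -
  define g where "g N = real (additive_energy N d (S N)) / real (card (S N)) ^ 3" for N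
  have bounds: "0 < g N" "g N \<le> 1" "- 2 * ln (fourier_algebra_norm N d (S N)) \<le> ln (g N)"
    if "N \<in> M" for N
  proof -
    define n where "n = real (card (S N))"
    define a where "a = fourier_algebra_norm N d (S N)"
    have N: "N > 0" using M that by auto
    have SN: "S N \<subseteq> ZN N d" "S N \<noteq> {}" using S[OF that] by auto
    have n: "n > 0" using SN finite_subset[OF SN(1) finite_ZN] by (simp add: n_def card_gt_0_iff)
    have a: "a \<ge> 1" unfolding a_def by (rule fourier_algebra_norm_ge_1[OF N SN])
    have "n ^ 3 \<le> a\<^sup>2 * real (additive_energy N d (S N))"
      unfolding n_def a_def by (rule additive_energy_ge[OF N SN])
    hence ga: "1 \<le> a\<^sup>2 * g N" using n by (simp add: g_def flip: n_def)
    thus g0: "0 < g N" using a by (smt (verit) mult_nonneg_nonpos zero_le_power2)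
    show "g N \<le> 1" using additive_energy_le[OF N SN(1)] n by (simp add: g_def flip: n_def)
    have "0 \<le> ln (a\<^sup>2 * g N)" using ga by simp
    also have "\<dots> = 2 * ln a + ln (g N)" using a g0 by (simp add: ln_mult ln_realpow)
    finally show "- 2 * ln a \<le> ln (g N)" by simp
  qed
  have lnN: "ln (real N) > 0" if "N \<in> M" for N using M that by auto
  have "((\<lambda>N. ln (g N) / ln (real N)) \<longlongrightarrow> 0) (at_top_in M)"
  proof (rule tendsto_sandwich)
    show "((\<lambda>N. - 2 * (ln (fourier_algebra_norm N d (S N)) / ln (real N))) \<longlongrightarrow> 0) (at_top_in M)"
      using tendsto_mult[OF tendsto_const A, of "- 2"] by simp
    show "((\<lambda>N. 0) \<longlongrightarrow> (0::real)) (at_top_in M)" by simp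
    show "eventually (\<lambda>N. - 2 * (ln (fourier_algebra_norm N d (S N)) / ln (real N)) \<le>
        ln (g N) / ln (real N)) (at_top_in M)"
      using eventually_at_top_in
    proof eventually_elim
      case (elim N)
      thus ?case using divide_right_mono[OF bounds(3), of N "ln (real N)"] lnN[of N] by simp
    qed
    show "eventually (\<lambda>N. ln (g N) / ln (real N) \<le> 0) (at_top_in M)"
      using eventually_at_top_in
    proof eventually_elim
      case (elim N)
      have "ln (g N) \<le> 0" using bounds(1,2)[OF elim] by simp
      thus ?case using lnN[OF elim] by (simp add: divide_nonpos_pos)
    qed
  qed
  thus ?thesis using bounds(1) by (simp add: subpoly_factor_def g_def)
qed

theorem corollary8p4:
  "(\<exists>c C :: real. c > 0 \<and> C > 0 \<and>
      (\<forall>(N::nat) (d::nat) S. N \<ge> 2 \<longrightarrow> d \<ge> 1 \<longrightarrow> S \<subseteq> ZN N d \<longrightarrow> S \<noteq> {} \<longrightarrow>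
        (\<exists>B \<subseteq> S.
           real (card B) \<ge> c * fourier_algebra_norm N d S powr (- C) * real (card S) \<and>
           real (card (sumset N d B B)) \<le> C * fourier_algebra_norm N d S powr C * real (card B))))
   \<and>
   (\<forall>(d::nat) (M::nat set) (S :: nat \<Rightarrow> (nat \<Rightarrow> nat) set) (\<alpha>::real).
      d \<ge> 1 \<longrightarrow> M \<subseteq> {2..} \<longrightarrow> \<not> bdd_above M \<longrightarrow>
      (\<forall>N\<in>M. S N \<subseteq> ZN N d \<and> S N \<noteq> {}) \<longrightarrow>
      ((\<lambda>N. ln (real (card (S N))) / ln (real N)) \<longlongrightarrow> \<alpha>) (at_top_in M) \<longrightarrow>
      kappa M d (\<lambda>N. indicator (S N)) = ereal (\<alpha> / 2) \<longrightarrow>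
      (\<exists>g. subpoly_factor M g \<and>
         (\<forall>N\<in>M. real (additive_energy N d (S N)) = real (card (S N)) ^ 3 * g N)) \<and>
      (\<exists>B g h. subpoly_factor M g \<and> subpoly_factor M h \<and>
         (\<forall>N\<in>M. B N \<subseteq> S N \<and>
            real (card (B N)) \<ge> g N * real (card (S N)) \<and>
            real (card (sumset N d (B N) (B N))) \<le> h N * real (card (B N)))))"
proof (rule conjI)
  show "\<exists>c C :: real. c > 0 \<and> C > 0 \<and>
      (\<forall>(N::nat) (d::nat) S. N \<ge> 2 \<longrightarrow> d \<ge> 1 \<longrightarrow> S \<subseteq> ZN N d \<longrightarrow> S \<noteq> {} \<longrightarrow>
        (\<exists>B \<subseteq> S.
           real (card B) \<ge> c * fourier_algebra_norm N d S powr (- C) * real (card S) \<and>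
           real (card (sumset N d B B)) \<le> C * fourier_algebra_norm N d S powr C * real (card B)))"
    by (rule exI[of _ "1 / 2 ^ 16"], rule exI[of _ "2 ^ 28"])
       (intro conjI allI impI small_doubling_subset_powr; simp)
next
  show "\<forall>(d::nat) (M::nat set) (S :: nat \<Rightarrow> (nat \<Rightarrow> nat) set) (\<alpha>::real).
      d \<ge> 1 \<longrightarrow> M \<subseteq> {2..} \<longrightarrow> \<not> bdd_above M \<longrightarrow>
      (\<forall>N\<in>M. S N \<subseteq> ZN N d \<and> S N \<noteq> {}) \<longrightarrow>
      ((\<lambda>N. ln (real (card (S N))) / ln (real N)) \<longlongrightarrow> \<alpha>) (at_top_in M) \<longrightarrow>
      kappa M d (\<lambda>N. indicator (S N)) = ereal (\<alpha> / 2) \<longrightarrow>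
      (\<exists>g. subpoly_factor M g \<and>
         (\<forall>N\<in>M. real (additive_energy N d (S N)) = real (card (S N)) ^ 3 * g N)) \<and>
      (\<exists>B g h. subpoly_factor M g \<and> subpoly_factor M h \<and>
         (\<forall>N\<in>M. B N \<subseteq> S N \<and>
            real (card (B N)) \<ge> g N * real (card (S N)) \<and>
            real (card (sumset N d (B N) (B N))) \<le> h N * real (card (B N))))"
  proof (intro allI impI)
    fix d :: nat and M :: "nat set" and S :: "nat \<Rightarrow> (nat \<Rightarrow> nat) set" and \<alpha> :: real
    assume M: "M \<subseteq> {2..}" and S: "\<forall>N\<in>M. S N \<subseteq> ZN N d \<and> S N \<noteq> {}"
      and card: "((\<lambda>N. ln (real (card (S N))) / ln (real N)) \<longlongrightarrow> \<alpha>) (at_top_in M)"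
      and kappa: "kappa M d (\<lambda>N. indicator (S N)) = ereal (\<alpha> / 2)"
    define A where "A N = fourier_algebra_norm N d (S N)" for N
    have A0: "((\<lambda>N. ln (A N) / ln (real N)) \<longlongrightarrow> 0) (at_top_in M)"
      unfolding A_def using M S card kappa
      by (intro fourier_algebra_norm_subpolynomial) auto
    have pos: "0 < N" "S N \<subseteq> ZN N d" "S N \<noteq> {}" if "N \<in> M" for N
      using M S that by auto
    have A: "A N > 0" if "N \<in> M" for N
      using fourier_algebra_norm_ge_1[OF pos[OF that]] by (simp add: A_def)
    have "subpoly_factor M (\<lambda>N. real (additive_energy N d (S N)) / real (card (S N)) ^ 3)"
      using M S A0 unfolding A_def by (intro energy_ratio_subpoly_factor) auto
    moreover have "real (card (S N)) > 0" if "N \<in> M" for N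
      using pos(2,3)[OF that] finite_subset[OF pos(2)[OF that] finite_ZN] by (simp add: card_gt_0_iff)
    ultimately have energy: "\<exists>g. subpoly_factor M g \<and>
        (\<forall>N\<in>M. real (additive_energy N d (S N)) = real (card (S N)) ^ 3 * g N)"
      by (intro exI[of _ "\<lambda>N. real (additive_energy N d (S N)) / real (card (S N)) ^ 3"]) force
    \<comment> \<open>The uniform statement is applied at every modulus. Its constants do not depend
      on \<open>N\<close>, so its factors are fixed multiples of fixed powers of \<open>A N\<close>,
      hence subpolynomial.\<close>
    have "\<forall>N\<in>M. \<exists>B\<subseteq>S N.
        real (card B) \<ge> 1 / 2 ^ 16 * A N powr (- (2 ^ 28)) * real (card (S N)) \<and>
        real (card (sumset N d B B)) \<le> 2 ^ 28 * A N powr (2 ^ 28) * real (card B)"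
      unfolding A_def using pos by (intro ballI small_doubling_subset_powr)
    then obtain B where "\<forall>N\<in>M. B N \<subseteq> S N \<and>
        real (card (B N)) \<ge> 1 / 2 ^ 16 * A N powr (- (2 ^ 28)) * real (card (S N)) \<and>
        real (card (sumset N d (B N) (B N))) \<le> 2 ^ 28 * A N powr (2 ^ 28) * real (card (B N))"
      by metis
    moreover have "subpoly_factor M (\<lambda>N. 1 / 2 ^ 16 * A N powr (- (2 ^ 28)))"
      "subpoly_factor M (\<lambda>N. 2 ^ 28 * A N powr (2 ^ 28))"
      using A A0 by (intro subpoly_factor_powr; simp)+
    ultimately have "\<exists>B g h. subpoly_factor M g \<and> subpoly_factor M h \<and>
         (\<forall>N\<in>M. B N \<subseteq> S N \<and>
            real (card (B N)) \<ge> g N * real (card (S N)) \<and>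
            real (card (sumset N d (B N) (B N))) \<le> h N * real (card (B N)))"
      by blast
    with energy show "(\<exists>g. subpoly_factor M g \<and>
         (\<forall>N\<in>M. real (additive_energy N d (S N)) = real (card (S N)) ^ 3 * g N)) \<and>
      (\<exists>B g h. subpoly_factor M g \<and> subpoly_factor M h \<and>
         (\<forall>N\<in>M. B N \<subseteq> S N \<and>
            real (card (B N)) \<ge> g N * real (card (S N)) \<and>
            real (card (sumset N d (B N) (B N))) \<le> h N * real (card (B N))))"
      by blast
  qed
qed

end
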